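(* Let $X$ be a Banach space. Assume that for each bounded sequence $(x_n)$ in $X$ there is a subsequence $(x_{n_k})$ and $x\in X$ such that for any further subsequence $(x_{n_{k_l}})$ and any $y\in\operatorname{span}(\{x\}\cup\{x_{n_k}: k\in\mathbb N\})$ we have $$\limsup_l\|x_{n_{k_l}}+y\|=\|y+x\|+\limsup_l\|x_{n_{k_l}}-x\|.$$ Then $X$ has both the $1$-Schur property and the $1$-strong Schur property.
   Context: $X$ is a Banach space over $\mathbb F\in\{\mathbb R,\mathbb C\}$; the span is over $\mathbb F$. For a bounded sequence put $\operatorname{ca}(x_n)=\inf_{n}\operatorname{diam}\{x_k: k\ge n\}$ (also for scalar sequences) and $\delta(x_n)=\sup\{\operatorname{ca}(x^*(x_n)): x^*\in B_{X^*}\}$. $X$ has the $1$-Schur property if $\operatorname{ca}(x_n)\le\delta(x_n)$ for each bounded sequence $(x_n)$ in $X$. $X$ has the $1$-strong Schur property if for any $\delta\in(0,2]$, any $\varepsilon>0$ and any normalized $\delta$-separated sequence in $X$ (i.e. $\|x_n\|=1$ and $\|x_n-x_m\|\ge\delta$ for $n\neq m$) there is a subsequence which is $(\frac2\delta+\varepsilon)$-equivalent to the standard basis of $\ell_1$; a normalized sequence $(y_j)$ is $K$-equivalent to the standard basis of $\ell_1$ if $\frac1K\sum_{j=1}^m|\alpha_j|\le\|\sum_{j=1}^m\alpha_jy_j\|$ for all $m$ and $\alpha_1,\dots,\alpha_m\in\mathbb F$. *)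

theory Defs
  imports "HOL-Analysis.Analysis"
begin

text \<open>
  The scalar field is \<open>\<real>\<close> or \<open>\<complex>\<close>, up to isometric isomorphism. Both types are instances.
\<close>

class real_or_complex = real_normed_field +
  assumes real_or_complex:
    "(\<forall>z. \<exists>a. z = a *\<^sub>R 1) \<or>
     (\<exists>i. i * i = - 1 \<and>
          (\<forall>z. \<exists>a b. z = a *\<^sub>R 1 + b *\<^sub>R i) \<and>
          (\<forall>a b. norm (a *\<^sub>R 1 + b *\<^sub>R i) = sqrt (a\<^sup>2 + b\<^sup>2)))"

instance real :: real_or_complex
  by standard simp

instance complex :: real_or_complex
proof
  have "\<exists>a b. z = a *\<^sub>R 1 + b *\<^sub>R \<i>" for z
    by (rule exI[of _ "Re z"], rule exI[of _ "Im z"]) (simp add: complex_eq_iff)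
  moreover have "norm (a *\<^sub>R 1 + b *\<^sub>R \<i>) = sqrt (a\<^sup>2 + b\<^sup>2)" for a b
    by (simp add: cmod_def)
  ultimately show
    "(\<forall>z::complex. \<exists>a. z = a *\<^sub>R 1) \<or>
     (\<exists>i::complex. i * i = - 1 \<and>
          (\<forall>z. \<exists>a b. z = a *\<^sub>R 1 + b *\<^sub>R i) \<and>
          (\<forall>a b. norm (a *\<^sub>R 1 + b *\<^sub>R i) = sqrt (a\<^sup>2 + b\<^sup>2)))"
    by (intro disjI2 exI[of _ \<i>]) auto
qed

text \<open>
  Completeness and the norm come from the class \<open>banach\<close>, whose real scalar
  multiplication is required to be the restriction of the multiplication by scalars in \<open>'k\<close>.
\<close>

locale banach_space_over = vector_space smul
  for smul :: "'k::real_or_complex \<Rightarrow> 'a::banach \<Rightarrow> 'a" +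
  assumes norm_smul: "norm (smul c x) = norm c * norm x"
    and smul_of_real: "smul (of_real r) x = r *\<^sub>R x"

lemma banach_space_over_scaleR:
  "banach_space_over (scaleR :: real \<Rightarrow> 'a::banach \<Rightarrow> 'a)"
  by unfold_locales (simp_all add: algebra_simps)

lemma banach_space_over_complex:
  "banach_space_over ((*) :: complex \<Rightarrow> complex \<Rightarrow> complex)"
  by unfold_locales (simp_all add: algebra_simps norm_mult scaleR_conv_of_real)

definition dual_unit_ball ::
    "('k::real_or_complex \<Rightarrow> 'a::banach \<Rightarrow> 'a) \<Rightarrow> ('a \<Rightarrow> 'k) set" where
  "dual_unit_ball smul =
     {f. Vector_Spaces.linear smul (*) f \<and> bounded_linear f \<and> onorm f \<le> 1}"

text \<open>
  In the next two definitions the infimum and the supremum are real-valued; they are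
  meaningful for bounded sequences, the only ones to which they are applied.
\<close>

definition ca :: "(nat \<Rightarrow> 'a::metric_space) \<Rightarrow> real" where
  "ca x = (INF n. diameter {x k | k. k \<ge> n})"

definition weak_ca :: "('k::real_or_complex \<Rightarrow> 'a::banach \<Rightarrow> 'a) \<Rightarrow> (nat \<Rightarrow> 'a) \<Rightarrow> real" where
  "weak_ca smul x = (SUP f\<in>dual_unit_ball smul. ca (\<lambda>n. f (x n)))"

definition one_Schur :: "('k::real_or_complex \<Rightarrow> 'a::banach \<Rightarrow> 'a) \<Rightarrow> bool" where
  "one_Schur smul \<longleftrightarrow> (\<forall>x. bounded (range x) \<longrightarrow> ca x \<le> weak_ca smul x)"

definition equivalent_to_ell1_basis ::
    "('k::real_or_complex \<Rightarrow> 'a::banach \<Rightarrow> 'a) \<Rightarrow> real \<Rightarrow> (nat \<Rightarrow> 'a) \<Rightarrow> bool" where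
  "equivalent_to_ell1_basis smul K y \<longleftrightarrow>
     (\<forall>j. norm (y j) = 1) \<and>
     (\<forall>m \<alpha>. 1 / K * (\<Sum>j<m. norm (\<alpha> j)) \<le> norm (\<Sum>j<m. smul (\<alpha> j) (y j)))"

definition one_strong_Schur :: "('k::real_or_complex \<Rightarrow> 'a::banach \<Rightarrow> 'a) \<Rightarrow> bool" where
  "one_strong_Schur smul \<longleftrightarrow>
     (\<forall>\<delta> \<epsilon> (x :: nat \<Rightarrow> 'a). 0 < \<delta> \<and> \<delta> \<le> 2 \<and> 0 < \<epsilon> \<and>
        (\<forall>n. norm (x n) = 1) \<and> (\<forall>n m. n \<noteq> m \<longrightarrow> \<delta> \<le> norm (x n - x m)) \<longrightarrow>
        (\<exists>r. strict_mono r \<and> equivalent_to_ell1_basis smul (2 / \<delta> + \<epsilon>) (x \<circ> r)))"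

end

theory Submission
  imports Defs
begin

text \<open>
  Let \<open>(x n)\<close> be bounded. After passing to a subsequence, \<open>z n = x n - a\<close> satisfies
  \<open>norm (z n + y) \<longlonglongrightarrow> norm y + c\<close> for all \<open>y\<close> in the span of \<open>a\<close> and the subsequence. The decisive
  step (\<open>ell1_type_of_tendsto_on_span\<close>) is that this persists for every \<open>y\<close> in the space. It is needed
  because the Schur property compares two different subsequences, neither of which need lie in the span
  that the assumption provides for the other one. It is obtained by applying the assumption once more, to
  a subsequence translated by a large multiple of \<open>y\<close>: up to a bounded error that translation has to
  be absorbed by the new point \<open>b\<close>, so the span that contains \<open>b\<close> contains vectors close to \<open>y\<close>.

  Given such sequences, compactness and induction select terms that satisfy, up to a small error, the
  lower estimate of an \<open>\<ell>\<^sub>1\<close>-basis scaled by \<open>c\<close>, even jointly with one further vector and with terms from several sequences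
  (\<open>ell1_type_selection\<close>).

  For a normalized \<open>\<delta>\<close>-separated sequence, \<open>\<delta> \<le> 2 c\<close>, and the selected subsequence is equivalent to
  the basis of \<open>\<ell>\<^sub>1\<close> with a constant as close to \<open>2 / \<delta>\<close> as desired.

  For the Schur property, choose subsequences \<open>a + z n\<close> and \<open>b + w n\<close> of \<open>(x n)\<close> whose members with
  equal index are at least almost \<open>ca x\<close> apart. The Hahn--Banach theorem in the form of Mazur and Orlicz
  (\<open>linear_le_norm_ge_on_sequence\<close>) gives a functional in the dual ball that is almost norming
  simultaneously at \<open>a - b\<close>, at terms of \<open>z\<close> and at terms of \<open>- w\<close>, hence separates infinitely many
  terms of \<open>(x n)\<close> from infinitely many others by almost \<open>ca x\<close>.
\<close>

section \<open>Sublinear functionals and the Hahn--Banach theorem\<close>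

text \<open>
  Positive homogeneity is required for all \<open>t \<ge> 0\<close>, so that \<open>q 0 = 0\<close> is part of the notion.
\<close>
definition sublinear :: "('a::real_vector \<Rightarrow> real) \<Rightarrow> bool" where
  "sublinear q \<longleftrightarrow>
     (\<forall>x y. q (x + y) \<le> q x + q y) \<and> (\<forall>t x. 0 \<le> t \<longrightarrow> q (t *\<^sub>R x) = t * q x)"

lemma sublinear_add: "sublinear q \<Longrightarrow> q (x + y) \<le> q x + q y"
  and sublinear_scaleR: "sublinear q \<Longrightarrow> 0 \<le> t \<Longrightarrow> q (t *\<^sub>R x) = t * q x"
  by (auto simp: sublinear_def)

lemma sublinear_zero: "sublinear q \<Longrightarrow> q 0 = 0"
  using sublinear_scaleR[of q 0 0] by simp

lemma sublinear_uminus_le: "sublinear q \<Longrightarrow> - q (- x) \<le> q x"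
  using sublinear_add[of q x "- x"] sublinear_zero[of q] by simp

lemma sublinear_norm: "sublinear (norm :: 'a::real_normed_vector \<Rightarrow> real)"
  by (simp add: sublinear_def norm_triangle_ineq)

lemma sublinearI:
  assumes add: "\<And>x y. q (x + y) \<le> q x + q y"
    and scale: "\<And>t x. 0 < t \<Longrightarrow> q (t *\<^sub>R x) \<le> t * q x"
    and zero: "q 0 = 0"
  shows "sublinear q"
  unfolding sublinear_def
proof (intro conjI allI impI add)
  fix t :: real and x :: 'a
  assume "0 \<le> t"
  show "q (t *\<^sub>R x) = t * q x"
  proof (cases "t = 0")
    case False
    with \<open>0 \<le> t\<close> have t: "0 < t" by simp
    have "q x \<le> inverse t * q (t *\<^sub>R x)"
      using scale[of "inverse t" "t *\<^sub>R x"] t by simp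
    then have "t * q x \<le> q (t *\<^sub>R x)"
      using t by (simp add: field_simps)
    with scale[OF t, of x] show ?thesis by simp
  qed (simp add: zero)
qed

text \<open>
  The auxiliary functional of Mazur and Orlicz: if \<open>c \<le> q s\<close> on a convex cone \<open>A\<close> of pairs
  \<open>(s, c)\<close>, then \<open>p x = inf (q (x + s) - c)\<close>, with the infimum over \<open>A\<close>, is again sublinear, and
  every linear functional \<open>f\<close> below \<open>p\<close> satisfies \<open>f s = - f (- s) \<ge> c\<close> on \<open>A\<close>.
\<close>
lemma sublinear_reduce:
  fixes q :: "'a::real_vector \<Rightarrow> real" and A :: "('a \<times> real) set"
  assumes q: "sublinear q"
    and zero: "(0, 0) \<in> A"
    and add: "\<And>u v. u \<in> A \<Longrightarrow> v \<in> A \<Longrightarrow> u + v \<in> A"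
    and scale: "\<And>t u. 0 < t \<Longrightarrow> u \<in> A \<Longrightarrow> t *\<^sub>R u \<in> A"
    and bound: "\<And>s c. (s, c) \<in> A \<Longrightarrow> c \<le> q s"
  obtains p where "sublinear p" "\<And>x. p x \<le> q x" "\<And>s c. (s, c) \<in> A \<Longrightarrow> p (- s) \<le> - c"
proof
  define p where "p x = (INF u\<in>A. q (x + fst u) - snd u)" for x
  have ne: "A \<noteq> {}" using zero by auto
  have lower: "- q (- x) \<le> q (x + s) - c" if "(s, c) \<in> A" for x s c
    using sublinear_add[OF q, of "x + s" "- x"] bound[OF that] by simp
  have p_le: "p x \<le> q (x + s) - c" if "(s, c) \<in> A" for x s c
    unfolding p_def
    using lower by (intro cINF_lower2[OF _ that]) (auto intro!: bdd_belowI2[where m = "- q (- x)"])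
  have p_ge: "m \<le> p x" if "\<And>s c. (s, c) \<in> A \<Longrightarrow> m \<le> q (x + s) - c" for m x
    unfolding p_def using that by (intro cINF_greatest[OF ne]) auto
  show p_le_q: "p x \<le> q x" for x
    using p_le[OF zero, of x] by simp
  show "p (- s) \<le> - c" if "(s, c) \<in> A" for s c
    using p_le[OF that, of "- s"] sublinear_zero[OF q] by simp
  show "sublinear p"
  proof (rule sublinearI)
    fix x y
    have *: "p (x + y) \<le> (q (x + s) - c) + (q (y + s') - c')"
      if "(s, c) \<in> A" "(s', c') \<in> A" for s c s' c'
      using p_le[of "s + s'" "c + c'" "x + y"] add[OF that]
        sublinear_add[OF q, of "x + s" "y + s'"] by (simp add: algebra_simps)
    have "p (x + y) - (q (x + s) - c) \<le> p y" if "(s, c) \<in> A" for s c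
      using *[OF that] by (intro p_ge) (simp add: algebra_simps)
    then have "p (x + y) - p y \<le> p x"
      by (intro p_ge) (simp add: algebra_simps)
    then show "p (x + y) \<le> p x + p y" by simp
  next
    fix t :: real and x
    assume t: "0 < t"
    have "p (t *\<^sub>R x) \<le> t * (q (x + s) - c)" if "(s, c) \<in> A" for s c
      using p_le[of "t *\<^sub>R s" "t * c" "t *\<^sub>R x"] scale[OF t that]
        sublinear_scaleR[OF q, of t "x + s"] t by (simp add: algebra_simps)
    then have "p (t *\<^sub>R x) / t \<le> p x"
      using t by (intro p_ge) (simp add: field_simps)
    then show "p (t *\<^sub>R x) \<le> t * p x"
      using t by (simp add: field_simps)
  next
    show "p 0 = 0"
      using p_le_q[of 0] p_ge[of "- q (- 0)" 0] lower[of _ _ 0] sublinear_zero[OF q] by force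
  qed
qed

lemma sublinear_INF_chain:
  fixes C :: "('a::real_vector \<Rightarrow> real) set"
  assumes ne: "C \<noteq> {}"
    and C: "\<And>q. q \<in> C \<Longrightarrow> sublinear q" "\<And>q x. q \<in> C \<Longrightarrow> q x \<le> p x"
    and chain: "\<And>q r. q \<in> C \<Longrightarrow> r \<in> C \<Longrightarrow> (\<forall>x. q x \<le> r x) \<or> (\<forall>x. r x \<le> q x)"
  shows "sublinear (\<lambda>x. INF q\<in>C. q x)"
    and "q \<in> C \<Longrightarrow> (INF q\<in>C. q x) \<le> q x"
proof -
  define i where "i x = (INF q\<in>C. q x)" for x
  have "- p (- x) \<le> q x" if "q \<in> C" for q x
    using sublinear_uminus_le[OF C(1)[OF that], of x] C(2)[OF that, of "- x"] by linarith
  then have bdd: "bdd_below ((\<lambda>q. q x) ` C)" for x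
    by (intro bdd_belowI2[where m = "- p (- x)" for x])
  have i_le: "i x \<le> q x" if "q \<in> C" for q x
    unfolding i_def by (rule cINF_lower[OF bdd that])
  then show "q \<in> C \<Longrightarrow> (INF q\<in>C. q x) \<le> q x"
    by (simp add: i_def)
  have i_ge: "m \<le> i x" if "\<And>q. q \<in> C \<Longrightarrow> m \<le> q x" for m x
    unfolding i_def using that by (intro cINF_greatest[OF ne])
  have "sublinear i"
  proof (rule sublinearI)
    fix x y
    have *: "i (x + y) \<le> q x + r y" if "q \<in> C" "r \<in> C" for q r
      using chain[OF that]
    proof
      assume "\<forall>x. q x \<le> r x"
      then have "q y \<le> r y" ..
      then show ?thesis
        using i_le[OF that(1), of "x + y"] sublinear_add[OF C(1)[OF that(1)], of x y]
        by linarith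
    next
      assume "\<forall>x. r x \<le> q x"
      then have "r x \<le> q x" ..
      then show ?thesis
        using i_le[OF that(2), of "x + y"] sublinear_add[OF C(1)[OF that(2)], of x y]
        by linarith
    qed
    have "i (x + y) - q x \<le> i y" if "q \<in> C" for q
      using *[OF that] by (intro i_ge) (simp add: algebra_simps)
    then have "i (x + y) - i y \<le> i x"
      by (intro i_ge) (simp add: algebra_simps)
    then show "i (x + y) \<le> i x + i y" by simp
  next
    fix t :: real and x
    assume t: "0 < t"
    have "i (t *\<^sub>R x) \<le> t * q x" if "q \<in> C" for q
      using i_le[OF that, of "t *\<^sub>R x"] sublinear_scaleR[OF C(1)[OF that], of t x] t by simp
    then have "i (t *\<^sub>R x) / t \<le> i x"
      using t by (intro i_ge) (simp add: field_simps)
    then show "i (t *\<^sub>R x) \<le> t * i x"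
      using t by (simp add: field_simps)
  next
    show "i 0 = 0"
      using ne C(1) by (simp add: i_def sublinear_zero)
  qed
  then show "sublinear (\<lambda>x. INF q\<in>C. q x)"
    by (simp add: i_def[abs_def])
qed

text \<open>
  Reducing \<open>q\<close> along the ray spanned by \<open>(s, q s)\<close> cannot change a minimal \<open>q\<close>; hence
  \<open>q (- s) \<le> - q s\<close>, so \<open>q\<close> is odd, and an odd sublinear functional is linear.
\<close>
lemma minimal_sublinear_imp_linear:
  fixes q :: "'a::real_vector \<Rightarrow> real"
  assumes q: "sublinear q"
    and minimal: "\<And>p. sublinear p \<Longrightarrow> (\<And>x. p x \<le> q x) \<Longrightarrow> p = q"
  shows "linear q"
proof -
  have neg: "q (- s) = - q s" for s
  proof -
    let ?A = "{(t *\<^sub>R s, t * q s) | t. 0 \<le> t}"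
    have "\<exists>p. sublinear p \<and> (\<forall>x. p x \<le> q x) \<and> (\<forall>x c. (x, c) \<in> ?A \<longrightarrow> p (- x) \<le> - c)"
    proof (rule sublinear_reduce[OF q, of ?A])
      show "u + v \<in> ?A" if "u \<in> ?A" "v \<in> ?A" for u v
      proof -
        from that obtain t t' where "u = (t *\<^sub>R s, t * q s)" "v = (t' *\<^sub>R s, t' * q s)" "0 \<le> t" "0 \<le> t'"
          by auto
        then show ?thesis
          by (auto intro!: exI[of _ "t + t'"] simp: algebra_simps)
      qed
      show "t *\<^sub>R u \<in> ?A" if "0 < t" "u \<in> ?A" for t u
      proof -
        from that obtain t' where "u = (t' *\<^sub>R s, t' * q s)" "0 \<le> t'"
          by auto
        then show ?thesis
          using that(1) by (auto intro!: exI[of _ "t * t'"])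
      qed
      show "(0, 0) \<in> ?A" by (auto intro!: exI[of _ "0 :: real"])
      show "c \<le> q x" if "(x, c) \<in> ?A" for x c
        using that by (auto simp: sublinear_scaleR[OF q])
    qed blast
    then obtain p where p: "sublinear p" "\<And>x. p x \<le> q x" "\<And>x c. (x, c) \<in> ?A \<Longrightarrow> p (- x) \<le> - c"
      by blast
    have "(s, q s) \<in> ?A" by (auto intro!: exI[of _ "1 :: real"])
    then have "q (- s) \<le> - q s"
      using p(3) minimal[OF p(1,2)] by auto
    with sublinear_uminus_le[OF q, of s] show ?thesis by simp
  qed
  show ?thesis
  proof (rule linearI)
    fix x y
    have "q x \<le> q (x + y) + q (- y)"
      using sublinear_add[OF q, of "x + y" "- y"] by simp
    then show "q (x + y) = q x + q y"
      using sublinear_add[OF q, of x y] neg[of y] by simp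
  next
    fix t :: real and x
    show "q (t *\<^sub>R x) = t *\<^sub>R q x"
    proof (cases "0 \<le> t")
      case False
      then show ?thesis
        using sublinear_scaleR[OF q, of "- t" x] neg[of "t *\<^sub>R x"] by simp
    qed (simp add: sublinear_scaleR[OF q])
  qed
qed

text \<open>
  The Hahn--Banach theorem, by Zorn's lemma applied to the sublinear functionals below \<open>p\<close>.
\<close>
theorem linear_below_sublinear:
  fixes p :: "'a::real_vector \<Rightarrow> real"
  assumes p: "sublinear p"
  obtains f where "linear f" "\<And>x. f x \<le> p x"
proof -
  let ?S = "{q. sublinear q \<and> (\<forall>x. q x \<le> p x)}"
  let ?P = "\<lambda>q r :: 'a \<Rightarrow> real. \<forall>x. r x \<le> q x"
  have "\<exists>m\<in>?S. \<forall>q\<in>?S. ?P m q \<longrightarrow> q = m"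
  proof (rule predicate_Zorn)
    show "partial_order_on ?S (relation_of ?P ?S)"
      by (rule partial_order_on_relation_ofI) (auto intro: order_trans intro!: ext order_antisym)
    fix C assume C: "C \<in> Chains (relation_of ?P ?S)"
    show "\<exists>u\<in>?S. \<forall>q\<in>C. ?P q u"
    proof (cases "C = {}")
      case True
      then show ?thesis using p by auto
    next
      case False
      have CS: "sublinear q" "q x \<le> p x" if "q \<in> C" for q x
        using C that by (auto simp: Chains_def relation_of_def)
      have chain: "(\<forall>x. q x \<le> r x) \<or> (\<forall>x. r x \<le> q x)" if "q \<in> C" "r \<in> C" for q r
        using C that by (auto simp: Chains_def relation_of_def)
      have inf: "sublinear (\<lambda>x. INF q\<in>C. q x)" "\<And>q x. q \<in> C \<Longrightarrow> (INF q\<in>C. q x) \<le> q x"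
        using sublinear_INF_chain[of C p] False CS chain by blast+
      show ?thesis
      proof (intro bexI[of _ "\<lambda>x. INF q\<in>C. q x"] ballI allI CollectI conjI)
        fix x
        from False obtain q where "q \<in> C" by auto
        then show "(INF q\<in>C. q x) \<le> p x"
          using inf(2)[of q x] CS(2)[of q x] by linarith
      qed (use inf in auto)
    qed
  qed
  then obtain m where m: "sublinear m" "\<And>x. m x \<le> p x"
    and min: "\<And>q. q \<in> ?S \<Longrightarrow> ?P m q \<Longrightarrow> q = m"
    by blast
  have "linear m"
  proof (rule minimal_sublinear_imp_linear[OF m(1)])
    fix q assume "sublinear q" "\<And>x. q x \<le> m x"
    moreover from this m(2) have "q x \<le> p x" for x
      using order_trans by blast
    ultimately show "q = m" by (intro min) auto
  qed
  with m(2) that show ?thesis by blast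
qed

corollary linear_le_norm_ge_on_cone:
  fixes A :: "('a::real_normed_vector \<times> real) set"
  assumes "(0, 0) \<in> A"
    and "\<And>u v. u \<in> A \<Longrightarrow> v \<in> A \<Longrightarrow> u + v \<in> A"
    and "\<And>t u. 0 < t \<Longrightarrow> u \<in> A \<Longrightarrow> t *\<^sub>R u \<in> A"
    and "\<And>s c. (s, c) \<in> A \<Longrightarrow> c \<le> norm s"
  obtains f where "linear f" "\<And>x. f x \<le> norm x" "\<And>s c. (s, c) \<in> A \<Longrightarrow> c \<le> f s"
proof -
  obtain p where p: "sublinear p" "\<And>x. p x \<le> norm x" "\<And>s c. (s, c) \<in> A \<Longrightarrow> p (- s) \<le> - c"
    using sublinear_reduce[OF sublinear_norm assms] by blast
  obtain f where f: "linear f" "\<And>x. f x \<le> p x"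
    using linear_below_sublinear[OF p(1)] by blast
  show ?thesis
  proof (rule that[OF f(1)])
    show "f x \<le> norm x" for x
      using f(2)[of x] p(2)[of x] by linarith
    show "c \<le> f s" if "(s, c) \<in> A" for s c
      using f(2)[of "- s"] p(3)[OF that] linear_neg[OF f(1), of s] by simp
  qed
qed

text \<open>
  The Mazur--Orlicz form of the Hahn--Banach theorem for a sequence of vectors \<open>s j\<close> with prescribed
  lower bounds \<open>c j\<close>. It yields one functional for the whole sequence at once, with no appeal to
  weak-star compactness.
\<close>

corollary linear_le_norm_ge_on_sequence:
  fixes s :: "nat \<Rightarrow> 'a::real_normed_vector" and c :: "nat \<Rightarrow> real"
  assumes le: "\<And>m t. (\<And>j. 0 \<le> t j) \<Longrightarrow>
    (\<Sum>j<m. t j * c j) \<le> norm (\<Sum>j<m. t j *\<^sub>R s j)"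
  obtains f where "linear f" "\<And>x. f x \<le> norm x" "\<And>j. c j \<le> f (s j)"
proof -
  define A where "A = {(\<Sum>j<m. t j *\<^sub>R (s j, c j)) | m t. \<forall>j::nat. 0 \<le> t j}"
  \<comment> \<open>Padding with zeros brings two combinations to the same length before they are added.\<close>
  have pad: "\<exists>t'. (\<forall>j. 0 \<le> t' j) \<and> (\<Sum>j<m. t j *\<^sub>R (s j, c j)) = (\<Sum>j<m'. t' j *\<^sub>R (s j, c j))"
    if "\<forall>j. 0 \<le> t j" "m \<le> m'" for m m' :: nat and t :: "nat \<Rightarrow> real"
    using that
    by (intro exI[of _ "\<lambda>j. if j < m then t j else 0"] conjI sum.mono_neutral_cong_left) (auto simp: zero_prod_def)
  have A_I: "(\<Sum>j<m. t j *\<^sub>R (s j, c j)) \<in> A" if "\<forall>j. 0 \<le> t j" for m :: nat and t :: "nat \<Rightarrow> real"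
    using that by (auto simp only: A_def)
  have "\<exists>f. linear f \<and> (\<forall>x. f x \<le> norm x) \<and> (\<forall>s c. (s, c) \<in> A \<longrightarrow> c \<le> f s)"
  proof (rule linear_le_norm_ge_on_cone[of A])
    show "(0, 0) \<in> A"
      by (auto simp: A_def zero_prod_def intro!: exI[of _ "0::nat"] exI[of _ "\<lambda>_. 0::real"])
    show "u + v \<in> A" if "u \<in> A" "v \<in> A" for u v
    proof -
      from that obtain m m' t t' where
        "u = (\<Sum>j<m. t j *\<^sub>R (s j, c j))" "\<forall>j::nat. 0 \<le> t j"
        "v = (\<Sum>j<m'. t' j *\<^sub>R (s j, c j))" "\<forall>j::nat. 0 \<le> t' j"
        unfolding A_def by blast
      with pad[of t m "max m m'"] pad[of t' m' "max m m'"] obtain t t' where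
        t: "u = (\<Sum>j<max m m'. t j *\<^sub>R (s j, c j))" "\<forall>j. 0 \<le> t j"
        "v = (\<Sum>j<max m m'. t' j *\<^sub>R (s j, c j))" "\<forall>j. 0 \<le> t' j"
        by auto
      then have "u + v = (\<Sum>j<max m m'. (t j + t' j) *\<^sub>R (s j, c j))"
        by (simp only: scaleR_left_distrib sum.distrib)
      moreover have "\<forall>j. 0 \<le> t j + t' j" using t by simp
      ultimately show ?thesis using A_I by metis
    qed
    show "q *\<^sub>R u \<in> A" if "0 < q" "u \<in> A" for q u
    proof -
      from that obtain m t where t: "u = (\<Sum>j<m. t j *\<^sub>R (s j, c j))" "\<forall>j::nat. 0 \<le> t j"
        unfolding A_def by blast
      then have "q *\<^sub>R u = (\<Sum>j<m. (q * t j) *\<^sub>R (s j, c j))"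
        by (simp only: scaleR_sum_right scaleR_scaleR)
      moreover have "\<forall>j. 0 \<le> q * t j" using t that(1) by simp
      ultimately show ?thesis using A_I by metis
    qed
    show "c' \<le> norm x" if "(x, c') \<in> A" for x c'
    proof -
      from that obtain m t where t: "(x, c') = (\<Sum>j<m. t j *\<^sub>R (s j, c j))" "\<forall>j::nat. 0 \<le> t j"
        unfolding A_def by blast
      from arg_cong[OF t(1), of fst] arg_cong[OF t(1), of snd]
      have "x = (\<Sum>j<m. t j *\<^sub>R s j)" "c' = (\<Sum>j<m. t j * c j)"
        by (simp_all add: fst_sum snd_sum)
      with le[of t m] t(2) show ?thesis by simp
    qed
  qed blast
  then obtain f where f: "linear f" "\<And>x. f x \<le> norm x" "\<And>s c. (s, c) \<in> A \<Longrightarrow> c \<le> f s"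
    by blast
  show ?thesis
  proof (rule that[OF f(1,2)])
    fix k
    have "(\<Sum>j<Suc k. (if j = k then 1 else 0) *\<^sub>R (s j, c j)) = (\<Sum>j<Suc k. if j = k then (s j, c j) else 0)"
      by (intro sum.cong) (auto simp: zero_prod_def)
    also have "\<dots> = (s k, c k)" by simp
    finally have "(s k, c k) \<in> A"
      unfolding A_def by (intro CollectI exI[of _ "Suc k"] exI[of _ "\<lambda>j. if j = k then 1 else 0"]) auto
    then show "c k \<le> f (s k)" by (rule f(3))
  qed
qed

section \<open>Sequences of asymptotic \<open>\<ell>\<^sub>1\<close> type\<close>

text \<open>
  A sequence such that \<open>norm (z n + y)\<close> tends to \<open>norm y + c\<close> for every vector \<open>y\<close> of the space:
  relative to a fixed \<open>y\<close>, far members behave like \<open>c\<close> times a new basis vector of \<open>\<ell>\<^sub>1\<close>. The value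
  \<open>c = 0\<close>, that is, a null sequence, is included.
\<close>
definition ell1_type :: "(nat \<Rightarrow> 'a::real_normed_vector) \<Rightarrow> real \<Rightarrow> bool" where
  "ell1_type z c \<longleftrightarrow> (\<forall>y. (\<lambda>n. norm (z n + y)) \<longlonglongrightarrow> norm y + c)"

lemma ell1_type_tendsto: "ell1_type z c \<Longrightarrow> (\<lambda>n. norm (z n + y)) \<longlonglongrightarrow> norm y + c"
  by (simp add: ell1_type_def)

lemma ell1_type_tendsto_norm: "ell1_type z c \<Longrightarrow> (\<lambda>n. norm (z n)) \<longlonglongrightarrow> c"
  using ell1_type_tendsto[of z c 0] by simp

lemma ell1_type_uminus:
  assumes "ell1_type z c" shows "ell1_type (\<lambda>n. - z n) c"
  unfolding ell1_type_def
proof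
  fix y
  have "norm (- z n + y) = norm (z n + (- y))" for n
    by (metis add.commute diff_conv_add_uminus norm_minus_commute)
  then show "(\<lambda>n. norm (- z n + y)) \<longlonglongrightarrow> norm y + c"
    using ell1_type_tendsto[OF assms, of "- y"] by simp
qed

lemma ell1_type_subseq:
  assumes "ell1_type z c" "strict_mono r" shows "ell1_type (\<lambda>n. z (r n)) c"
  unfolding ell1_type_def
  using LIMSEQ_subseq_LIMSEQ[OF ell1_type_tendsto[OF assms(1)] assms(2)] by (simp add: o_def)

lemma tendsto_of_limsup_subseq:
  fixes s :: "nat \<Rightarrow> real"
  assumes "\<And>k. strict_mono k \<Longrightarrow> limsup (\<lambda>l. ereal (s (k l))) = ereal L"
  shows "s \<longlonglongrightarrow> L"
proof -
  obtain r where r: "strict_mono r" "((\<lambda>l. ereal (s l)) \<circ> r) \<longlonglongrightarrow> liminf (\<lambda>l. ereal (s l))"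
    using liminf_subseq_lim by blast
  then have "limsup (\<lambda>l. ereal (s (r l))) = liminf (\<lambda>l. ereal (s l))"
    using lim_imp_Limsup[OF sequentially_bot r(2)] by (simp add: o_def)
  then have "liminf (\<lambda>l. ereal (s l)) = ereal L"
    using assms[OF r(1)] by simp
  moreover have "limsup (\<lambda>l. ereal (s l)) = ereal L"
    using assms[of id] by (simp add: strict_mono_id)
  ultimately have "(\<lambda>l. ereal (s l)) \<longlonglongrightarrow> ereal L"
    by (intro iffD2[OF tendsto_iff_Liminf_eq_Limsup[OF sequentially_bot]] conjI)
  then show ?thesis by simp
qed

context banach_space_over
begin

lemma smul_real_in_span: "v \<in> span S \<Longrightarrow> r *\<^sub>R v \<in> span S"
  using span_scale[of v S "of_real r"] by (simp add: smul_of_real)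

text \<open>
  Along a subsequence on which \<open>norm (x n - a)\<close> converges, the condition on upper limits of all
  further subsequences becomes a limit. The vector \<open>y - a\<close> takes the place of \<open>y\<close>.
\<close>
lemma subseq_tendsto_on_span:
  fixes x :: "nat \<Rightarrow> 'a" and n :: "nat \<Rightarrow> nat"
  assumes bdd: "bounded (range x)"
    and n: "strict_mono n"
    and lim: "\<And>k y. strict_mono k \<Longrightarrow> y \<in> span ({a} \<union> range (\<lambda>i. x (n i))) \<Longrightarrow>
      limsup (\<lambda>l. ereal (norm (x (n (k l)) + y))) =
      ereal (norm (y + a)) + limsup (\<lambda>l. ereal (norm (x (n (k l)) - a)))"
  shows "\<exists>(r :: nat \<Rightarrow> nat) c. strict_mono r \<and>
    (\<forall>y \<in> span ({a} \<union> range (\<lambda>i. x (r i))). (\<lambda>i. norm (x (r i) - a + y)) \<longlonglongrightarrow> norm y + c)"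
proof -
  from bdd obtain M where M: "\<And>n. norm (x n) \<le> M"
    by (auto simp: bounded_iff)
  have "norm (x (n i) - a) \<le> M + norm a" for i
    using norm_triangle_ineq4[of "x (n i)" a] M[of "n i"] by linarith
  then have "bounded (range (\<lambda>i. norm (x (n i) - a)))"
    by (auto simp: bounded_iff)
  then obtain c k where k: "strict_mono k" and c: "((\<lambda>i. norm (x (n i) - a)) \<circ> k) \<longlonglongrightarrow> c"
    using bounded_imp_convergent_subsequence[of "\<lambda>i. norm (x (n i) - a)"] by blast
  show ?thesis
  proof (intro exI conjI ballI)
    show "strict_mono (n \<circ> k)"
      using n k by (rule strict_mono_o)
    fix y assume y: "y \<in> span ({a} \<union> range (\<lambda>i. x ((n \<circ> k) i)))"
    have "{a} \<union> range (\<lambda>i. x ((n \<circ> k) i)) \<subseteq> {a} \<union> range (\<lambda>i. x (n i))"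
      by auto
    then have "y \<in> span ({a} \<union> range (\<lambda>i. x (n i)))"
      using y span_mono by blast
    then have ya: "y - a \<in> span ({a} \<union> range (\<lambda>i. x (n i)))"
      by (intro span_diff[OF _ span_base]) auto
    show "(\<lambda>i. norm (x ((n \<circ> k) i) - a + y)) \<longlonglongrightarrow> norm y + c"
    proof (rule tendsto_of_limsup_subseq)
      fix l :: "nat \<Rightarrow> nat" assume l: "strict_mono l"
      have "(\<lambda>i. ereal (norm (x (n (k (l i))) - a))) \<longlonglongrightarrow> ereal c"
        using LIMSEQ_subseq_LIMSEQ[OF c l] by (simp add: o_def)
      then have "limsup (\<lambda>i. ereal (norm (x (n (k (l i))) - a))) = ereal c"
        by (simp add: lim_imp_Limsup)
      then show "limsup (\<lambda>i. ereal (norm (x ((n \<circ> k) (l i)) - a + y))) = ereal (norm y + c)"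
        using lim[OF strict_mono_o[OF k l] ya] by (simp add: algebra_simps)
    qed
  qed
qed

text \<open>
  The limit formula passes from the span of the sequence to the whole space. Suppose that it fails at
  \<open>y\<close> by \<open>\<eta>\<close> along a subsequence. Let \<open>b\<close> be the point that the assumed property of bounded sequences
  provides for this subsequence of \<open>x - a\<close>, translated by a large multiple \<open>T y\<close>, and let \<open>w\<close> be the
  resulting further subsequence of \<open>x - a\<close>. Evaluating the limit of \<open>norm (w i - w m)\<close> in two ways shows
  that \<open>h = T y - b\<close> is bounded by \<open>2 c\<close>, independently of \<open>T\<close>. So \<open>b / T\<close>, which lies in the new span, is
  within \<open>2 c / T\<close> of \<open>y\<close>, and the formula at \<open>b / T\<close> forces \<open>\<eta> \<le> 4 c / T\<close>.
\<close>
lemma ell1_type_of_tendsto_on_span: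
  fixes x :: "nat \<Rightarrow> 'a"
  assumes property: "\<And>x :: nat \<Rightarrow> 'a. bounded (range x) \<Longrightarrow>
      \<exists>(r :: nat \<Rightarrow> nat) a c. strict_mono r \<and> (\<forall>y \<in> span ({a} \<union> range (\<lambda>i. x (r i))).
        (\<lambda>i. norm (x (r i) - a + y)) \<longlonglongrightarrow> norm y + c)"
    and bdd: "bounded (range x)"
    and lim: "\<And>y. y \<in> span ({a} \<union> range x) \<Longrightarrow>
      (\<lambda>i. norm (x i - a + y)) \<longlonglongrightarrow> norm y + c"
  shows "ell1_type (\<lambda>i. x i - a) c"
  unfolding ell1_type_def
proof (intro allI order_tendstoI)
  define z where "z i = x i - a" for i
  have z_lim: "(\<lambda>i. norm (z i)) \<longlonglongrightarrow> c"
    using lim[OF span_zero] by (simp add: z_def)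
  then have c: "0 \<le> c"
    by (rule LIMSEQ_le_const) simp
  fix y :: 'a and u
  {
    assume u: "norm y + c < u"
    have "(\<lambda>i. norm (z i) + norm y) \<longlonglongrightarrow> c + norm y"
      by (intro tendsto_intros z_lim)
    then have "eventually (\<lambda>i. norm (z i) + norm y < u) sequentially"
      using u by (intro order_tendstoD(2)[of _ "c + norm y"]) auto
    then show "eventually (\<lambda>i. norm (x i - a + y) < u) sequentially"
      unfolding z_def[symmetric]
      by eventually_elim (use norm_triangle_ineq in \<open>fastforce intro: order_le_less_trans\<close>)
  }
  assume u: "u < norm y + c"
  show "eventually (\<lambda>i. u < norm (x i - a + y)) sequentially"
  proof (rule ccontr)
    assume "\<not> ?thesis"
    then have "\<not> eventually (\<lambda>i. u < norm (z i + y)) sequentially"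
      by (simp add: z_def)
    from not_eventually_sequentiallyD[OF this]
    obtain k :: "nat \<Rightarrow> nat" where k: "strict_mono k" "\<And>i. norm (z (k i) + y) \<le> u"
      unfolding not_less by blast
    define \<eta> where "\<eta> = norm y + c - u"
    have \<eta>: "0 < \<eta>" using u by (simp add: \<eta>_def)
    \<comment> \<open>With this choice the final estimate \<open>T * \<eta> \<le> 4 * c\<close> is contradictory.\<close>
    define T where "T = 4 * c / \<eta> + 1"
    have T: "0 < T" using c \<eta> by (simp add: T_def add_nonneg_pos)
    have "bounded (range (\<lambda>i. x (k i) - a + T *\<^sub>R y))"
    proof -
      from bdd obtain M where M: "\<And>n. norm (x n) \<le> M"
        by (auto simp: bounded_iff)
      have "norm (x (k i) - a + T *\<^sub>R y) \<le> M + norm a + norm (T *\<^sub>R y)" for i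
        using norm_triangle_ineq4[of "x (k i)" a] M[of "k i"]
          norm_triangle_ineq[of "x (k i) - a" "T *\<^sub>R y"] by linarith
      then show ?thesis by (auto simp: bounded_iff)
    qed
    from property[OF this] obtain r :: "nat \<Rightarrow> nat" and b c' where r: "strict_mono r"
      and lim': "\<And>v. v \<in> span ({b} \<union> range (\<lambda>i. x (k (r i)) - a + T *\<^sub>R y)) \<Longrightarrow>
        (\<lambda>i. norm (x (k (r i)) - a + T *\<^sub>R y - b + v)) \<longlonglongrightarrow> norm v + c'"
      by blast
    define w where "w i = z (k (r i))" for i
    define h where "h = T *\<^sub>R y - b"
    let ?S = "span ({b} \<union> range (\<lambda>i. x (k (r i)) - a + T *\<^sub>R y))"
    have kr: "strict_mono (k \<circ> r)" using k(1) r by (rule strict_mono_o)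
    have w_lim: "(\<lambda>i. norm (w i + v)) \<longlonglongrightarrow> norm v + c" if "v \<in> span ({a} \<union> range x)" for v
      using LIMSEQ_subseq_LIMSEQ[OF lim[OF that] kr] by (simp add: o_def w_def z_def)
    have w_norm: "(\<lambda>i. norm (w i)) \<longlonglongrightarrow> c"
      using w_lim[OF span_zero] by simp
    have wh_lim: "(\<lambda>i. norm (w i + h + v)) \<longlonglongrightarrow> norm v + c'" if "v \<in> ?S" for v
      using lim'[OF that] by (simp add: w_def z_def h_def algebra_simps)
    have wh_norm: "(\<lambda>i. norm (w i + h)) \<longlonglongrightarrow> c'"
      using wh_lim[OF span_zero] by simp
    have wh_span: "- (w m + h) \<in> ?S" for m
    proof -
      have "b - (x (k (r m)) - a + T *\<^sub>R y) \<in> ?S"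
        by (intro span_diff span_base) auto
      then show ?thesis by (simp add: w_def z_def h_def algebra_simps)
    qed
    have w_span: "- w m \<in> span ({a} \<union> range x)" for m
    proof -
      have "a - x (k (r m)) \<in> span ({a} \<union> range x)"
        by (intro span_diff span_base) auto
      then show ?thesis by (simp add: w_def z_def)
    qed
    \<comment> \<open>Both sides are the limit of \<open>norm (w i - w m)\<close> as \<open>i\<close> grows, in the old and in the new span.\<close>
    have eq: "norm (w m) + c = norm (w m + h) + c'" for m
    proof (rule LIMSEQ_unique)
      show "(\<lambda>i. norm (w i - w m)) \<longlonglongrightarrow> norm (w m) + c"
        using w_lim[OF w_span[of m]] by simp
      show "(\<lambda>i. norm (w i - w m)) \<longlonglongrightarrow> norm (w m + h) + c'"
        using wh_lim[OF wh_span[of m]]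
        by (simp only: norm_minus_cancel) (simp add: algebra_simps)
    qed
    have "(\<lambda>m. norm (w m) + c) \<longlonglongrightarrow> c' + c'"
      unfolding eq by (intro tendsto_intros wh_norm)
    moreover have "(\<lambda>m. norm (w m) + c) \<longlonglongrightarrow> c + c"
      by (intro tendsto_intros w_norm)
    ultimately have c': "c' = c"
      using LIMSEQ_unique by fastforce
    have h: "norm h \<le> 2 * c"
    proof -
      have "norm h \<le> norm (w m) + norm (w m)" for m
        using norm_triangle_ineq4[of "w m + h" "w m"] eq[of m] c' by simp
      moreover have lim2: "(\<lambda>m. norm (w m) + norm (w m)) \<longlonglongrightarrow> c + c"
        by (intro tendsto_intros w_norm)
      ultimately have "norm h \<le> c + c"
        by (intro LIMSEQ_le_const[OF lim2]) blast
      then show ?thesis by simp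
    qed
    have b: "b /\<^sub>R T = y - h /\<^sub>R T"
      using T by (simp add: h_def algebra_simps)
    have b_span: "b /\<^sub>R T \<in> ?S"
      by (intro smul_real_in_span span_base) auto
    have hT: "norm (h /\<^sub>R T) \<le> 2 * c / T"
      using h T by (simp add: field_simps)
    have upper: "norm (w m + h - b /\<^sub>R T) + c \<le> u + norm (w m) + 2 * c / T" for m
    proof -
      have "b /\<^sub>R T - (w m + h) \<in> ?S"
        using span_add[OF b_span wh_span[of m]] by (simp only: diff_conv_add_uminus)
      from wh_lim[OF this]
      have l: "(\<lambda>i. norm (w i - w m + b /\<^sub>R T)) \<longlonglongrightarrow> norm (w m + h - b /\<^sub>R T) + c"
        by (simp add: c' norm_minus_commute[of "b /\<^sub>R T"] algebra_simps)
      have "norm (w i - w m + b /\<^sub>R T) \<le> u + norm (w m) + 2 * c / T" for i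
      proof -
        have eq_diff: "w i - w m + b /\<^sub>R T = (w i + y) - w m - h /\<^sub>R T"
          by (simp add: b)
        have "norm (w i - w m + b /\<^sub>R T) \<le> norm (w i + y) + norm (w m) + norm (h /\<^sub>R T)"
          unfolding eq_diff using norm_triangle_ineq4[of "w i + y - w m" "h /\<^sub>R T"]
            norm_triangle_ineq4[of "w i + y" "w m"] by linarith
        then show ?thesis
          using k(2)[of "r i"] hT by (simp add: w_def)
      qed
      then show ?thesis
        using l by (intro LIMSEQ_le_const2) auto
    qed
    have "(\<lambda>m. norm (w m + h - b /\<^sub>R T) + c) \<longlonglongrightarrow> norm (b /\<^sub>R T) + c + c"
      using wh_lim[of "- (b /\<^sub>R T)"] span_neg[OF b_span] c'
      by (intro tendsto_intros) simp
    moreover have "(\<lambda>m. u + norm (w m) + 2 * c / T) \<longlonglongrightarrow> u + c + 2 * c / T"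
      by (intro tendsto_intros w_norm)
    ultimately have "norm (b /\<^sub>R T) + c + c \<le> u + c + 2 * c / T"
      using upper by (intro LIMSEQ_le) auto
    moreover have "norm y - 2 * c / T \<le> norm (b /\<^sub>R T)"
      using norm_triangle_ineq2[of y "h /\<^sub>R T"] hT b by simp
    ultimately have "\<eta> \<le> 4 * c / T"
      by (simp add: \<eta>_def)
    then have "T * \<eta> \<le> 4 * c"
      using T by (simp add: field_simps)
    moreover have "T * \<eta> = 4 * c + \<eta>"
      using \<eta> by (simp add: T_def field_simps)
    ultimately show False using \<eta> by simp
  qed
qed

end

section \<open>Selecting almost isometric \<open>\<ell>\<^sub>1\<close> sequences\<close>

lemma compact_unit_disc: "compact {\<alpha> :: 'k::real_or_complex. norm \<alpha> \<le> 1}"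
  using real_or_complex[where 'a = 'k]
proof
  assume all: "\<forall>z :: 'k. \<exists>a. z = a *\<^sub>R 1"
  have "compact ((\<lambda>a. a *\<^sub>R (1 :: 'k)) ` {-1..1})"
    by (intro compact_continuous_image continuous_intros) simp
  moreover have "(\<lambda>a. a *\<^sub>R (1 :: 'k)) ` {-1..1} = {\<alpha>. norm \<alpha> \<le> 1}"
  proof
    show "{\<alpha> :: 'k. norm \<alpha> \<le> 1} \<subseteq> (\<lambda>a. a *\<^sub>R 1) ` {-1..1}"
    proof
      fix \<alpha> :: 'k assume "\<alpha> \<in> {\<alpha>. norm \<alpha> \<le> 1}"
      moreover from all obtain a where "\<alpha> = a *\<^sub>R 1" by blast
      ultimately show "\<alpha> \<in> (\<lambda>a. a *\<^sub>R 1) ` {-1..1}" by (auto simp: abs_le_iff)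
    qed
  qed auto
  ultimately show ?thesis by simp
next
  assume "\<exists>i :: 'k. i * i = - 1 \<and> (\<forall>z. \<exists>a b. z = a *\<^sub>R 1 + b *\<^sub>R i) \<and>
    (\<forall>a b. norm (a *\<^sub>R 1 + b *\<^sub>R i) = sqrt (a\<^sup>2 + b\<^sup>2))"
  then obtain i :: 'k where i: "\<And>z. \<exists>a b. z = a *\<^sub>R 1 + b *\<^sub>R i"
    "\<And>a b. norm (a *\<^sub>R 1 + b *\<^sub>R i) = sqrt (a\<^sup>2 + b\<^sup>2)"
    by blast
  let ?f = "\<lambda>p :: real \<times> real. fst p *\<^sub>R 1 + snd p *\<^sub>R i"
  have "compact (?f ` cball 0 1)"
    by (intro compact_continuous_image continuous_intros) simp
  moreover have "?f ` cball 0 1 = {\<alpha>. norm \<alpha> \<le> 1}"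
  proof
    show "?f ` cball 0 1 \<subseteq> {\<alpha>. norm \<alpha> \<le> 1}"
      by (auto simp: i(2) norm_Pair)
    show "{\<alpha>. norm \<alpha> \<le> 1} \<subseteq> ?f ` cball 0 1"
    proof
      fix \<alpha> :: 'k assume "\<alpha> \<in> {\<alpha>. norm \<alpha> \<le> 1}"
      moreover from i(1) obtain a b where "\<alpha> = a *\<^sub>R 1 + b *\<^sub>R i" by blast
      ultimately show "\<alpha> \<in> ?f ` cball 0 1"
        by (auto simp: i(2) norm_Pair intro!: image_eqI[of _ _ "(a, b)"])
    qed
  qed
  ultimately show ?thesis by simp
qed

context banach_space_over
begin

lemma bounded_linear_smul_left: "bounded_linear (\<lambda>\<alpha>. smul \<alpha> x)"
proof (rule bounded_linear_intro)
  show "smul (r *\<^sub>R \<alpha>) x = r *\<^sub>R smul \<alpha> x" for r \<alpha>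
    by (simp add: scaleR_conv_of_real flip: scale_scale smul_of_real)
qed (auto simp: scale_left_distrib norm_smul)

lemma continuous_on_smul_left [continuous_intros]:
  "continuous_on S f \<Longrightarrow> continuous_on S (\<lambda>p. smul (f p) x)"
  by (rule bounded_linear.continuous_on[OF bounded_linear_smul_left])

lemma ell1_type_tendsto_smul:
  assumes "ell1_type z c"
  shows "(\<lambda>n. norm (y + smul \<alpha> (z n))) \<longlonglongrightarrow> norm y + norm \<alpha> * c"
proof (cases "\<alpha> = 0")
  case False
  have *: "norm (y + smul \<alpha> (z n)) = norm \<alpha> * norm (z n + smul (1 / \<alpha>) y)" for n
    using False by (simp add: scale_right_distrib add.commute flip: norm_smul)
  have "(\<lambda>n. norm \<alpha> * norm (z n + smul (1 / \<alpha>) y)) \<longlonglongrightarrow> norm \<alpha> * (norm (smul (1 / \<alpha>) y) + c)"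
    by (intro tendsto_intros ell1_type_tendsto assms)
  moreover have "norm \<alpha> * (norm (smul (1 / \<alpha>) y) + c) = norm y + norm \<alpha> * c"
    using False by (simp add: norm_smul norm_divide field_simps)
  ultimately show ?thesis unfolding * by simp
qed simp

text \<open>
  The maps \<open>(y, \<alpha>) \<mapsto> norm (y + \<alpha> z n)\<close> are uniformly Lipschitz, so their pointwise limit is uniform
  on compact sets.
\<close>
lemma ell1_type_eventually_uniform:
  assumes z: "ell1_type z c" and K: "compact K" and \<epsilon>: "0 < \<epsilon>"
  shows "eventually (\<lambda>n. \<forall>y\<in>K. \<forall>\<alpha>. norm \<alpha> \<le> 1 \<longrightarrow>
    norm y + norm \<alpha> * c - \<epsilon> \<le> norm (y + smul \<alpha> (z n))) sequentially"
proof (rule ccontr)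
  assume "\<not> ?thesis"
  from not_eventually_sequentiallyD[OF this]
  obtain r :: "nat \<Rightarrow> nat" where r: "strict_mono r" and neg: "\<And>n. \<exists>y\<in>K. \<exists>\<alpha>. norm \<alpha> \<le> 1 \<and>
      norm (y + smul \<alpha> (z (r n))) < norm y + norm \<alpha> * c - \<epsilon>"
    by (auto simp: not_le)
  have "\<exists>p \<in> K \<times> {\<alpha>. norm \<alpha> \<le> 1}.
      norm (fst p + smul (snd p) (z (r n))) < norm (fst p) + norm (snd p) * c - \<epsilon>" for n
    using neg[of n] by force
  then obtain p where p: "\<And>n. p n \<in> K \<times> {\<alpha>. norm \<alpha> \<le> 1}"
    "\<And>n. norm (fst (p n) + smul (snd (p n)) (z (r n))) < norm (fst (p n)) + norm (snd (p n)) * c - \<epsilon>"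
    by metis
  obtain q s where s: "strict_mono s" and lim: "(p \<circ> s) \<longlonglongrightarrow> q"
    using compact_Times[OF K compact_unit_disc] p(1) unfolding compact_def by metis
  have rs: "strict_mono (r \<circ> s)"
    using r s by (rule strict_mono_o)
  define w where "w n = z (r (s n))" for n
  have w: "ell1_type w c"
    using ell1_type_subseq[OF z rs] by (simp add: w_def[abs_def])
  define y where "y n = fst (p (s n))" for n
  define \<alpha> where "\<alpha> n = snd (p (s n))" for n
  have y: "y \<longlonglongrightarrow> fst q" and \<alpha>: "\<alpha> \<longlonglongrightarrow> snd q"
    using tendsto_fst[OF lim] tendsto_snd[OF lim] by (simp_all add: y_def[abs_def] \<alpha>_def[abs_def] o_def)
  have le: "norm (fst q + smul (snd q) (w n)) \<le>
    norm (y n) + norm (\<alpha> n) * c - \<epsilon> + norm (fst q - y n) + norm (snd q - \<alpha> n) * norm (w n)" for n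
  proof -
    have "fst q + smul (snd q) (w n) =
        (y n + smul (\<alpha> n) (w n)) + (fst q - y n) + smul (snd q - \<alpha> n) (w n)"
      by (simp add: scale_left_diff_distrib)
    then have "norm (fst q + smul (snd q) (w n)) \<le>
        norm (y n + smul (\<alpha> n) (w n)) + norm (fst q - y n) + norm (smul (snd q - \<alpha> n) (w n))"
      by (metis norm_triangle_le add_mono norm_triangle_ineq order_refl)
    then show ?thesis
      using p(2)[of "s n"] by (simp add: norm_smul y_def \<alpha>_def w_def)
  qed
  have "(\<lambda>n. norm (y n) + norm (\<alpha> n) * c - \<epsilon> + norm (fst q - y n) + norm (snd q - \<alpha> n) * norm (w n))
      \<longlonglongrightarrow> norm (fst q) + norm (snd q) * c - \<epsilon> + norm (fst q - fst q) + norm (snd q - snd q) * c"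
    by (intro tendsto_intros y \<alpha> ell1_type_tendsto_norm[OF w])
  from LIMSEQ_le[OF ell1_type_tendsto_smul[OF w] this] le \<epsilon> show False by force
qed

text \<open>
  One term chosen from each of countably many sequences of this kind: together with an arbitrary vector
  \<open>e\<close>, the chosen terms satisfy the lower estimate of an \<open>\<ell>\<^sub>1\<close>-sum, up to an error.
  The error \<open>\<eta> * S\<close> scales with a bound \<open>S\<close> for all the coefficients, so that the estimate is homogeneous.
\<close>
lemma ell1_type_selection:
  assumes Z: "\<And>j :: nat. ell1_type (Z j) (C j)" and \<eta>: "0 < \<eta>"
  shows "\<exists>r :: nat \<Rightarrow> nat. strict_mono r \<and>
    (\<forall>S m \<beta> \<alpha>. norm \<beta> \<le> S \<longrightarrow> (\<forall>j<m. norm (\<alpha> j) \<le> S) \<longrightarrow>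
       norm \<beta> * norm e + (\<Sum>j<m. norm (\<alpha> j) * C j) - \<eta> * S \<le>
       norm (smul \<beta> e + (\<Sum>j<m. smul (\<alpha> j) (Z j (r j)))))"
proof -
  let ?D = "{\<alpha> :: 'k. norm \<alpha> \<le> 1}"
  \<comment> \<open>A state \<open>(K, k)\<close> at step \<open>n\<close> consists of the compact set \<open>K\<close> of all partial sums of \<open>n\<close> chosen terms,
    with coefficients in the unit disc, and the index \<open>k\<close> of the next term; that term costs at most
    \<open>\<eta> / 2 ^ Suc n\<close> uniformly on \<open>K\<close>.\<close>
  define P :: "nat \<Rightarrow> 'a set \<times> nat \<Rightarrow> bool" where "P n = (\<lambda>(K, k). compact K \<and>
    (\<forall>y\<in>K. \<forall>\<alpha>\<in>?D. norm y + norm \<alpha> * C n - \<eta> / 2 ^ Suc n \<le> norm (y + smul \<alpha> (Z n k))) \<and>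
    (n = 0 \<longrightarrow> K = (\<lambda>\<beta>. smul \<beta> e) ` ?D))" for n
  define Q :: "nat \<Rightarrow> 'a set \<times> nat \<Rightarrow> 'a set \<times> nat \<Rightarrow> bool" where "Q n = (\<lambda>(K, k) (K', k').
    k < k' \<and> K' = (\<lambda>(y, \<alpha>). y + smul \<alpha> (Z n k)) ` (K \<times> ?D))" for n
  have step: "\<exists>k'>k. \<forall>y\<in>K. \<forall>\<alpha>\<in>?D.
      norm y + norm \<alpha> * C n - \<eta> / 2 ^ Suc n \<le> norm (y + smul \<alpha> (Z n k'))"
    if "compact K" for K k n
  proof -
    have "0 < \<eta> / 2 ^ Suc n" using \<eta> by simp
    from eventually_conj[OF ell1_type_eventually_uniform[OF Z[of n] that this] eventually_gt_at_top[of k]]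
    show ?thesis
      using eventually_happens'[OF sequentially_bot] by fastforce
  qed
  have "\<exists>s. \<forall>n. P n (s n) \<and> Q n (s n) (s (Suc n))"
  proof (rule dependent_nat_choice)
    have "compact ((\<lambda>\<beta>. smul \<beta> e) ` ?D)"
      by (intro compact_continuous_image continuous_intros compact_unit_disc)
    with step[OF this, of 0 0] show "\<exists>x. P 0 x"
      by (auto simp: P_def)
  next
    fix s n assume "P n s"
    then have K: "compact (fst s)" by (auto simp: P_def)
    let ?K' = "(\<lambda>(y, \<alpha>). y + smul \<alpha> (Z n (snd s))) ` (fst s \<times> ?D)"
    have K': "compact ?K'"
      unfolding case_prod_beta
      by (intro compact_continuous_image continuous_intros compact_Times compact_unit_disc K)
    from step[OF this, of "snd s" "Suc n"] obtain k' where "k' > snd s"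
      "\<forall>y\<in>?K'. \<forall>\<alpha>\<in>?D. norm y + norm \<alpha> * C (Suc n) - \<eta> / 2 ^ Suc (Suc n) \<le>
        norm (y + smul \<alpha> (Z (Suc n) k'))"
      by blast
    with K' have "P (Suc n) (?K', k')" "Q n s (?K', k')"
      by (simp_all only: P_def Q_def case_prod_beta fst_conv snd_conv) auto
    then show "\<exists>s'. P (Suc n) s' \<and> Q n s s'"
      by blast
  qed
  then obtain s where P: "\<And>n. P n (s n)" and Q: "\<And>n. Q n (s n) (s (Suc n))"
    by blast
  define r where "r n = snd (s n)" for n
  have le_1: "norm \<beta> * norm e + (\<Sum>j<m. norm (\<alpha> j) * C j) - \<eta> \<le>
      norm (smul \<beta> e + (\<Sum>j<m. smul (\<alpha> j) (Z j (r j))))"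
    if \<beta>: "norm \<beta> \<le> 1" and \<alpha>: "\<And>j. j < m \<Longrightarrow> norm (\<alpha> j) \<le> 1"
    for m \<beta> and \<alpha> :: "nat \<Rightarrow> 'k"
  proof -
    let ?y = "\<lambda>m. smul \<beta> e + (\<Sum>j<m. smul (\<alpha> j) (Z j (r j)))"
    have "(\<And>j. j < m \<Longrightarrow> norm (\<alpha> j) \<le> 1) \<Longrightarrow> ?y m \<in> fst (s m) \<and>
      norm \<beta> * norm e + (\<Sum>j<m. norm (\<alpha> j) * C j) - \<eta> * (1 - 1 / 2 ^ m) \<le> norm (?y m)"
    proof (induction m)
      case 0
      have "smul \<beta> e \<in> fst (s 0)"
        using P[of 0] \<beta> by (auto simp: P_def)
      then show ?case by (simp add: norm_smul)
    next
      case (Suc m)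
      have y: "?y m \<in> fst (s m)"
        and ih: "norm \<beta> * norm e + (\<Sum>j<m. norm (\<alpha> j) * C j) - \<eta> * (1 - 1 / 2 ^ m) \<le> norm (?y m)"
        using Suc by auto
      have \<alpha>: "norm (\<alpha> m) \<le> 1" using Suc by auto
      have eq: "?y (Suc m) = ?y m + smul (\<alpha> m) (Z m (r m))"
        by (simp add: add.assoc)
      have "?y (Suc m) \<in> fst (s (Suc m))"
        using Q[of m] y \<alpha> unfolding eq
        by (auto simp: Q_def r_def case_prod_beta intro!: image_eqI[of _ _ "(?y m, \<alpha> m)"])
      moreover have "norm (?y m) + norm (\<alpha> m) * C m - \<eta> / 2 ^ Suc m \<le> norm (?y (Suc m))"
        using P[of m] y \<alpha> unfolding eq by (auto simp: P_def r_def case_prod_beta)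
      moreover have "\<eta> * (1 - 1 / 2 ^ Suc m) = \<eta> * (1 - 1 / 2 ^ m) + \<eta> / 2 ^ Suc m"
        by (simp add: field_simps)
      ultimately show ?case using ih by simp
    qed
    moreover have "\<eta> * (1 - 1 / 2 ^ m) \<le> \<eta>"
      using \<eta> by (simp add: algebra_simps)
    ultimately show ?thesis
      using \<alpha> by (smt (verit))
  qed
  show ?thesis
  proof (intro exI conjI allI impI)
    show "strict_mono r"
      using Q by (auto simp: strict_mono_Suc_iff r_def Q_def case_prod_beta)
    fix S and m :: nat and \<beta> :: 'k and \<alpha> :: "nat \<Rightarrow> 'k"
    assume \<beta>: "norm \<beta> \<le> S" and \<alpha>: "\<forall>j<m. norm (\<alpha> j) \<le> S"
    let ?y = "smul \<beta> e + (\<Sum>j<m. smul (\<alpha> j) (Z j (r j)))"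
    show "norm \<beta> * norm e + (\<Sum>j<m. norm (\<alpha> j) * C j) - \<eta> * S \<le> norm ?y"
    proof (cases "S = 0")
      case True
      then show ?thesis using \<beta> \<alpha> by simp
    next
      case False
      then have S: "0 < S"
        using \<beta> norm_ge_zero[of \<beta>] by linarith
      define u :: 'k where "u = of_real (1 / S)"
      have u: "norm u = 1 / S" using S by (simp add: u_def norm_divide)
      have "norm (u * \<beta>) * norm e + (\<Sum>j<m. norm (u * \<alpha> j) * C j) - \<eta> \<le>
          norm (smul (u * \<beta>) e + (\<Sum>j<m. smul (u * \<alpha> j) (Z j (r j))))"
      proof (rule le_1)
        show "norm (u * \<beta>) \<le> 1" using \<beta> S by (simp add: norm_mult u)
        show "norm (u * \<alpha> j) \<le> 1" if "j < m" for j using \<alpha> that S by (simp add: norm_mult u)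
      qed
      also have "smul (u * \<beta>) e + (\<Sum>j<m. smul (u * \<alpha> j) (Z j (r j))) = smul u ?y"
        by (simp add: scale_right_distrib scale_sum_right)
      finally have "(norm \<beta> * norm e + (\<Sum>j<m. norm (\<alpha> j) * C j)) / S - \<eta> \<le> norm ?y / S"
        unfolding norm_smul norm_mult u by (simp add: add_divide_distrib sum_divide_distrib)
      then show ?thesis
        using S by (simp add: divide_le_cancel field_simps)
    qed
  qed
qed

end

section \<open>Oscillation of sequences and the dual unit ball\<close>

lemma ca_le_diameter:
  assumes "bounded (range x)"
  shows "ca x \<le> diameter {x k | k. k \<ge> n}"
proof -
  have "bounded {x k | k. k \<ge> m}" for m
    using assms by (rule bounded_subset) auto
  then show ?thesis
    unfolding ca_def by (intro cINF_lower bdd_belowI2[of _ 0] diameter_ge_0) auto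
qed

lemma le_ca:
  assumes bdd: "bounded (range x)"
    and far: "\<And>n. \<exists>i\<ge>n. \<exists>k\<ge>n. d \<le> dist (x i) (x k)"
  shows "d \<le> ca x"
  unfolding ca_def
proof (rule cINF_greatest)
  fix n
  obtain i k where ik: "i \<ge> n" "k \<ge> n" "d \<le> dist (x i) (x k)"
    using far by blast
  have "bounded {x k | k. k \<ge> n}"
    using bdd by (rule bounded_subset) auto
  then have "dist (x i) (x k) \<le> diameter {x k | k. k \<ge> n}"
    using ik by (intro diameter_bounded_bound) auto
  with ik(3) show "d \<le> diameter {x k | k. k \<ge> n}" by simp
qed simp

lemma less_caD:
  fixes x :: "nat \<Rightarrow> 'a::real_normed_vector"
  assumes "bounded (range x)" "d < ca x"
  shows "\<exists>i\<ge>n. \<exists>k\<ge>n. d < norm (x i - x k)"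
proof (rule ccontr)
  assume "\<not> ?thesis"
  then have "diameter {x k | k. k \<ge> n} \<le> d"
    by (intro diameter_le) (auto simp: not_less)
  with ca_le_diameter[OF assms(1), of n] assms(2) show False by simp
qed

context banach_space_over
begin

lemma dual_unit_ball_norm_le:
  assumes "f \<in> dual_unit_ball smul"
  shows "norm (f x) \<le> norm x"
proof -
  have "norm (f x) \<le> onorm f * norm x"
    using assms by (intro onorm) (simp add: dual_unit_ball_def)
  also have "\<dots> \<le> 1 * norm x"
    using assms by (intro mult_right_mono) (auto simp: dual_unit_ball_def)
  finally show ?thesis by simp
qed

lemma dual_unit_ballI:
  assumes add: "\<And>x y. F (x + y) = F x + F y"
    and smul: "\<And>c x. F (smul c x) = c * F x"
    and norm: "\<And>x. norm (F x) \<le> norm x"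
  shows "F \<in> dual_unit_ball smul"
proof -
  have "bounded_linear F"
  proof (rule bounded_linear_intro[of _ 1])
    show "F (r *\<^sub>R x) = r *\<^sub>R F x" for r x
      using smul[of "of_real r" x] by (simp add: smul_of_real scaleR_conv_of_real)
  qed (use add norm in simp_all)
  moreover have "Vector_Spaces.linear smul (*) F"
    by (simp add: Vector_Spaces.linear_def module_hom_def module_hom_axioms_def vector_space_axioms
        vector_space_over_itself.vector_space_axioms module_axioms vector_space_over_itself.module_axioms add smul)
  moreover have "onorm F \<le> 1"
    using norm by (intro onorm_bound) simp_all
  ultimately show ?thesis by (simp add: dual_unit_ball_def)
qed

text \<open>
  In the complex case \<open>F x = f x - i f (i x)\<close>; its norm is controlled by rotating \<open>F x\<close> to a real number.
  The comparison with \<open>dist\<close> holds because \<open>f\<close> is the real part of \<open>F\<close>.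
\<close>
lemma dual_functional_of_real_functional:
  assumes f: "linear f" and le: "\<And>x. f x \<le> norm x"
  obtains F where "F \<in> dual_unit_ball smul" "\<And>x y. f (x - y) \<le> dist (F x) (F y)"
  using real_or_complex[where 'a = 'k]
proof
  assume all: "\<forall>z :: 'k. \<exists>a. z = a *\<^sub>R 1"
  have abs: "\<bar>f x\<bar> \<le> norm x" for x
    using le[of x] le[of "- x"] linear_neg[OF f, of x] by simp
  show ?thesis
  proof (rule that)
    show "(\<lambda>x. of_real (f x)) \<in> dual_unit_ball smul"
    proof (rule dual_unit_ballI)
      fix c :: 'k and x
      from all obtain a where "c = of_real a" by (auto simp: scaleR_conv_of_real)
      then show "of_real (f (smul c x)) = c * of_real (f x)"
        by (simp add: smul_of_real linear_scale[OF f])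
    qed (use abs in \<open>simp_all add: linear_add[OF f]\<close>)
    show "f (x - y) \<le> dist (of_real (f x) :: 'k) (of_real (f y))" for x y
      by (simp add: dist_norm linear_diff[OF f] flip: of_real_diff)
  qed
next
  assume "\<exists>i :: 'k. i * i = - 1 \<and> (\<forall>z. \<exists>a b. z = a *\<^sub>R 1 + b *\<^sub>R i) \<and>
    (\<forall>a b. norm (a *\<^sub>R 1 + b *\<^sub>R i) = sqrt (a\<^sup>2 + b\<^sup>2))"
  then obtain i :: 'k where ii: "i * i = - 1" and i: "\<And>z. \<exists>a b. z = a *\<^sub>R 1 + b *\<^sub>R i"
    and norm_i: "\<And>a b. norm (a *\<^sub>R 1 + b *\<^sub>R i) = sqrt (a\<^sup>2 + b\<^sup>2)"
    by blast
  have real_part_le: "a \<le> norm (of_real a + of_real b * i)" for a b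
    using norm_i[of a b] by (simp add: scaleR_conv_of_real real_le_rsqrt)
  have real_part: "a = c" if "of_real a + of_real b * i = of_real c" for a b c
  proof -
    have "(a - c) *\<^sub>R 1 + b *\<^sub>R i = 0"
      using that by (simp add: scaleR_conv_of_real algebra_simps)
    with norm_i[of "a - c" b] show ?thesis by (simp add: sum_power2_eq_zero_iff)
  qed
  define F where "F x = of_real (f x) - of_real (f (smul i x)) * i" for x
  have F_add: "F (x + y) = F x + F y" for x y
    by (simp add: F_def scale_right_distrib linear_add[OF f] algebra_simps)
  have F_smul: "F (smul c x) = c * F x" for c x
  proof -
    obtain a b where c: "c = of_real a + of_real b * i"
      using i[of c] by (auto simp: scaleR_conv_of_real)
    have "smul c x = a *\<^sub>R x + b *\<^sub>R smul i x"
      by (simp add: c scale_left_distrib smul_of_real flip: scale_scale)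
    moreover have "smul i (smul c x) = a *\<^sub>R smul i x - b *\<^sub>R x"
    proof -
      have "i * c = of_real a * i + of_real b * (i * i)"
        by (simp add: c algebra_simps)
      also have "\<dots> = of_real a * i - of_real b"
        by (simp add: ii)
      finally have "i * c = of_real a * i - of_real b" .
      then have "smul i (smul c x) = smul (of_real a * i - of_real b) x"
        by simp
      then show ?thesis
        by (simp add: scale_left_diff_distrib smul_of_real flip: scale_scale)
    qed
    ultimately have F: "F (smul c x) = of_real (a * f x + b * f (smul i x))
        - of_real (a * f (smul i x) - b * f x) * i"
      unfolding F_def by (simp only: linear_add[OF f] linear_diff[OF f] linear_scale[OF f] real_scaleR_def)
    have "c * F x = of_real (a * f x) - of_real (a * f (smul i x)) * i
        + of_real (b * f x) * i - of_real (b * f (smul i x)) * (i * i)"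
      by (simp add: c F_def algebra_simps)
    then show ?thesis
      unfolding F ii by (simp add: algebra_simps)
  qed
  have norm_F: "norm (F x) \<le> norm x" for x
  proof (cases "F x = 0")
    case False
    define \<theta> where "\<theta> = of_real (norm (F x)) / F x"
    have "F (smul \<theta> x) = of_real (norm (F x))"
      using False unfolding F_smul by (simp add: \<theta>_def)
    then have "of_real (f (smul \<theta> x)) + of_real (- f (smul i (smul \<theta> x))) * i = of_real (norm (F x))"
      unfolding F_def[of "smul \<theta> x"] by (simp only: of_real_minus mult_minus_left diff_conv_add_uminus)
    then have "norm (F x) = f (smul \<theta> x)"
      using real_part by metis
    also have "\<dots> \<le> norm \<theta> * norm x"
      using le[of "smul \<theta> x"] by (simp add: norm_smul)
    also have "norm \<theta> = 1"
      using False by (simp add: \<theta>_def norm_divide)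
    finally show ?thesis by simp
  qed simp
  show ?thesis
  proof (rule that)
    show "F \<in> dual_unit_ball smul"
      using F_add F_smul norm_F by (rule dual_unit_ballI)
    show "f (x - y) \<le> dist (F x) (F y)" for x y
    proof -
      have "F x - F y = F (x - y)"
        using F_add[of "x - y" y] by simp
      then show ?thesis
        using real_part_le[of "f (x - y)" "- f (smul i (x - y))"] by (simp add: dist_norm F_def)
    qed
  qed
qed

text \<open>
  The supremum defining \<open>weak_ca\<close> is over a set that is bounded because \<open>x\<close> is; so each member is below it.
\<close>

lemma ca_le_weak_ca:
  assumes x: "bounded (range x)" and F: "F \<in> dual_unit_ball smul"
  shows "ca (\<lambda>n. F (x n)) \<le> weak_ca smul x"
  unfolding weak_ca_def
proof (rule cSUP_upper[OF F])
  from x obtain M where M: "\<And>n. norm (x n) \<le> M"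
    by (auto simp: bounded_iff)
  show "bdd_above ((\<lambda>f. ca (\<lambda>n. f (x n))) ` dual_unit_ball smul)"
  proof (rule bdd_aboveI2)
    fix f assume f: "f \<in> dual_unit_ball smul"
    have le: "norm (f (x n)) \<le> M" for n
      using dual_unit_ball_norm_le[OF f, of "x n"] M[of n] by simp
    then have "bounded (range (\<lambda>n. f (x n)))"
      by (auto simp: bounded_iff)
    then have "ca (\<lambda>n. f (x n)) \<le> diameter {f (x k) | k. k \<ge> 0}"
      by (rule ca_le_diameter)
    also have "\<dots> \<le> M + M"
      by (rule diameter_le) (use norm_triangle_ineq4 add_mono[OF le le] order_trans in fast)+
    finally show "ca (\<lambda>n. f (x n)) \<le> M + M" .
  qed
qed

end

section \<open>The two Schur properties\<close>

context banach_space_over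
begin

text \<open>
  Since \<open>norm (z n - z m)\<close> tends to \<open>2 c\<close> in the iterated limit, separation gives \<open>c \<ge> \<delta> / 2\<close>. The
  translation \<open>a\<close> only adds the nonnegative term \<open>norm (\<Sum>j<m. \<alpha> j) * norm a\<close> to the lower estimate.
\<close>
lemma one_strong_Schur_of_ell1_type_subseq:
  assumes subseq: "\<And>x :: nat \<Rightarrow> 'a. bounded (range x) \<Longrightarrow>
      \<exists>(r :: nat \<Rightarrow> nat) a c. strict_mono r \<and> ell1_type (\<lambda>i. x (r i) - a) c"
  shows "one_strong_Schur smul"
  unfolding one_strong_Schur_def
proof (intro allI impI, elim conjE)
  fix \<delta> \<epsilon> :: real and x :: "nat \<Rightarrow> 'a"
  assume \<delta>: "0 < \<delta>" and \<epsilon>: "0 < \<epsilon>" and norm_x: "\<forall>n. norm (x n) = 1"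
    and sep: "\<forall>n m. n \<noteq> m \<longrightarrow> \<delta> \<le> norm (x n - x m)"
  have "bounded (range x)"
    using norm_x by (auto simp: bounded_iff)
  from subseq[OF this] obtain r a c where r: "strict_mono (r :: nat \<Rightarrow> nat)"
    and ell1: "ell1_type (\<lambda>i. x (r i) - a) c"
    by blast
  define z where "z i = x (r i) - a" for i
  have z: "ell1_type z c"
    using ell1 by (simp add: z_def[abs_def])
  have "\<delta> \<le> norm (z m) + c" for m
  proof (rule LIMSEQ_le_const)
    show "(\<lambda>n. norm (z n - z m)) \<longlonglongrightarrow> norm (z m) + c"
      using ell1_type_tendsto[OF z, of "- z m"] by simp
    have "\<delta> \<le> norm (z n - z m)" if "n \<ge> Suc m" for n
      using sep that strict_mono_eq[OF r, of n m] by (simp add: z_def)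
    then show "\<exists>N. \<forall>n\<ge>N. \<delta> \<le> norm (z n - z m)" by blast
  qed
  moreover have lim: "(\<lambda>m. norm (z m) + c) \<longlonglongrightarrow> c + c"
    by (intro tendsto_intros ell1_type_tendsto_norm z)
  ultimately have "\<delta> \<le> c + c"
    by (intro LIMSEQ_le_const[OF lim]) blast
  define K where "K = 2 / \<delta> + \<epsilon>"
  have "1 / K < \<delta> / 2"
    using \<delta> \<epsilon> by (simp add: K_def field_simps add_pos_pos)
  with \<open>\<delta> \<le> c + c\<close> have "0 < c - 1 / K" by simp
  with ell1_type_selection[of "\<lambda>_. z" "\<lambda>_. c" "c - 1 / K" a] z
  obtain s :: "nat \<Rightarrow> nat" where s: "strict_mono s"
    and sel: "\<forall>S m \<beta> \<alpha>. norm \<beta> \<le> S \<longrightarrow> (\<forall>j<m. norm (\<alpha> j) \<le> S) \<longrightarrow>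
       norm \<beta> * norm a + (\<Sum>j<m. norm (\<alpha> j) * c) - (c - 1 / K) * S \<le>
       norm (smul \<beta> a + (\<Sum>j<m. smul (\<alpha> j) (z (s j))))"
    by blast
  have "1 / K * (\<Sum>j<m. norm (\<alpha> j)) \<le> norm (\<Sum>j<m. smul (\<alpha> j) (x (r (s j))))" for m \<alpha>
  proof -
    let ?S = "\<Sum>j<m. norm (\<alpha> j)"
    have "norm (\<alpha> j) \<le> ?S" if "j < m" for j
      using that by (intro member_le_sum) auto
    from sel[rule_format, OF norm_sum this] have "norm (\<Sum>j<m. \<alpha> j) * norm a + ?S * c - (c - 1 / K) * ?S \<le>
       norm (smul (\<Sum>j<m. \<alpha> j) a + (\<Sum>j<m. smul (\<alpha> j) (z (s j))))"
      by (simp add: sum_distrib_right)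
    also have "smul (\<Sum>j<m. \<alpha> j) a + (\<Sum>j<m. smul (\<alpha> j) (z (s j))) =
        (\<Sum>j<m. smul (\<alpha> j) (x (r (s j))))"
      by (simp add: z_def scale_sum_left scale_right_diff_distrib flip: sum.distrib)
    finally have "norm (\<Sum>j<m. \<alpha> j) * norm a + 1 / K * ?S \<le> norm (\<Sum>j<m. smul (\<alpha> j) (x (r (s j))))"
      by (simp add: algebra_simps)
    moreover have "0 \<le> norm (\<Sum>j<m. \<alpha> j) * norm a" by simp
    ultimately show ?thesis by linarith
  qed
  then have "equivalent_to_ell1_basis smul K (x \<circ> (r \<circ> s))"
    using norm_x by (simp add: equivalent_to_ell1_basis_def)
  with strict_mono_o[OF r s]
  show "\<exists>r. strict_mono r \<and> equivalent_to_ell1_basis smul (2 / \<delta> + \<epsilon>) (x \<circ> r)"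
    unfolding K_def by blast
qed

text \<open>
  Take pairs of members of \<open>x\<close> farther apart than \<open>d\<close>, and subsequences \<open>a + z\<close> and \<open>b + w\<close> of the two
  sequences of partners, so that \<open>d \<le> norm (a - b) + c + c'\<close>. A selection that alternates between \<open>z\<close> and \<open>- w\<close>
  then admits a functional that is almost maximal at \<open>a - b\<close>, at every chosen \<open>z\<close> and at every chosen \<open>- w\<close>;
  it separates the two subsequences by almost \<open>d\<close>, although the chosen indices no longer match in pairs.
\<close>
lemma one_Schur_of_ell1_type_subseq:
  assumes subseq: "\<And>x :: nat \<Rightarrow> 'a. bounded (range x) \<Longrightarrow>
      \<exists>(r :: nat \<Rightarrow> nat) a c. strict_mono r \<and> ell1_type (\<lambda>i. x (r i) - a) c"
  shows "one_Schur smul"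
  unfolding one_Schur_def
proof (intro allI impI)
  fix x :: "nat \<Rightarrow> 'a"
  assume bdd: "bounded (range x)"
  have sub_bdd: "bounded (range (\<lambda>n. x (k n)))" for k :: "nat \<Rightarrow> nat"
    using bdd by (rule bounded_subset) auto
  have main: "d - 3 * \<eta> \<le> weak_ca smul x" if d: "d < ca x" and \<eta>: "0 < \<eta>" for d \<eta>
  proof -
    obtain p q where pq: "\<And>n. p n \<ge> n" "\<And>n. q n \<ge> n" "\<And>n. d < norm (x (p n) - x (q n))"
      using less_caD[OF bdd d] by meson
    from subseq[OF sub_bdd[of p]] obtain r\<^sub>1 a c where r\<^sub>1: "strict_mono (r\<^sub>1 :: nat \<Rightarrow> nat)"
      and ell1_p: "ell1_type (\<lambda>i. x (p (r\<^sub>1 i)) - a) c"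
      by blast
    from subseq[OF sub_bdd[of "\<lambda>i. q (r\<^sub>1 i)"]] obtain r\<^sub>2 b c'
      where r\<^sub>2: "strict_mono (r\<^sub>2 :: nat \<Rightarrow> nat)"
      and ell1_q: "ell1_type (\<lambda>i. x (q (r\<^sub>1 (r\<^sub>2 i))) - b) c'"
      by blast
    define r where "r i = r\<^sub>1 (r\<^sub>2 i)" for i
    have r: "strict_mono r"
      using strict_mono_o[OF r\<^sub>1 r\<^sub>2] by (simp add: r_def[abs_def] o_def)
    define z where "z i = x (p (r i)) - a" for i
    define w where "w i = x (q (r i)) - b" for i
    define e where "e = a - b"
    have z: "ell1_type z c"
      using ell1_type_subseq[OF ell1_p r\<^sub>2] by (simp add: z_def[abs_def] r_def)
    have w: "ell1_type w c'"
      using ell1_q by (simp add: w_def[abs_def] r_def)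
    have "d \<le> norm e + c + c'"
    proof (rule LIMSEQ_le_const)
      show "(\<lambda>i. norm e + norm (z i) + norm (w i)) \<longlonglongrightarrow> norm e + c + c'"
        by (intro tendsto_intros ell1_type_tendsto_norm z w)
      have "d \<le> norm e + norm (z i) + norm (w i)" for i
      proof -
        have "d \<le> norm (e + z i - w i)"
          using pq(3)[of "r i"] by (simp add: e_def z_def w_def)
        also have "\<dots> \<le> norm e + norm (z i) + norm (w i)"
          using norm_triangle_ineq4[of "e + z i" "w i"] norm_triangle_ineq[of e "z i"] by linarith
        finally show ?thesis .
      qed
      then show "\<exists>N. \<forall>n\<ge>N. d \<le> norm e + norm (z n) + norm (w n)" by blast
    qed
    define Z where "Z j = (if even j then z else (\<lambda>i. - w i))" for j :: nat
    define C where "C j = (if even j then c else c')" for j :: nat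
    have Z: "ell1_type (Z j) (C j)" for j
      using z ell1_type_uminus[OF w] by (simp add: Z_def C_def)
    obtain s :: "nat \<Rightarrow> nat" where s: "strict_mono s"
      and sel: "\<forall>S m \<beta> \<alpha>. norm \<beta> \<le> S \<longrightarrow> (\<forall>j<m. norm (\<alpha> j) \<le> S) \<longrightarrow>
         norm \<beta> * norm e + (\<Sum>j<m. norm (\<alpha> j) * C j) - \<eta> * S \<le>
         norm (smul \<beta> e + (\<Sum>j<m. smul (\<alpha> j) (Z j (s j))))"
      using ell1_type_selection[of Z C \<eta> e, OF Z \<eta>] by blast
    define v where "v = case_nat e (\<lambda>j. Z j (s j))"
    define g where "g = case_nat (norm e - \<eta>) (\<lambda>j. C j - \<eta>)"
    have cone: "(\<Sum>j<m. t j * g j) \<le> norm (\<Sum>j<m. t j *\<^sub>R v j)" if t: "\<And>j. 0 \<le> t j"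
      for m :: nat and t :: "nat \<Rightarrow> real"
    proof (cases m)
      case (Suc m')
      let ?S = "t 0 + (\<Sum>j<m'. t (Suc j))"
      have "norm (of_real (t 0) :: 'k) \<le> ?S"
        using t by (simp add: sum_nonneg)
      moreover have "norm (of_real (t (Suc j)) :: 'k) \<le> ?S" if "j < m'" for j
        using t that member_le_sum[of j "{..<m'}" "\<lambda>j. t (Suc j)"] by (simp add: add_increasing)
      ultimately have "norm (of_real (t 0) :: 'k) * norm e +
          (\<Sum>j<m'. norm (of_real (t (Suc j)) :: 'k) * C j) - \<eta> * ?S \<le>
          norm (smul (of_real (t 0)) e + (\<Sum>j<m'. smul (of_real (t (Suc j))) (Z j (s j))))"
        by (rule sel[rule_format])
      then show ?thesis
        unfolding Suc sum.lessThan_Suc_shift using t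
        by (simp add: v_def g_def smul_of_real algebra_simps sum_subtractf sum_distrib_left)
    qed simp
    obtain f where f: "linear f" "\<And>x. f x \<le> norm x" and f_ge: "\<And>j. g j \<le> f (v j)"
      using linear_le_norm_ge_on_sequence[OF cone] by blast
    obtain F where F: "F \<in> dual_unit_ball smul" and F_dist: "\<And>x y. f (x - y) \<le> dist (F x) (F y)"
      using dual_functional_of_real_functional[OF f] by blast
    have "d - 3 * \<eta> \<le> ca (\<lambda>n. F (x n))"
    proof (rule le_ca)
      have "norm (F (x n)) \<le> norm (x n)" for n
        by (rule dual_unit_ball_norm_le[OF F])
      with bdd show "bounded (range (\<lambda>n. F (x n)))"
        unfolding bounded_iff by (auto intro: order_trans)
      fix n
      define i where "i = s (2 * n)"
      define k where "k = s (Suc (2 * n))"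
      have "n \<le> r i" "n \<le> r k"
        using seq_suble[OF s, of "2 * n"] seq_suble[OF s, of "Suc (2 * n)"]
          seq_suble[OF r, of i] seq_suble[OF r, of k] by (simp_all add: i_def k_def)
      then have "n \<le> p (r i)" "n \<le> q (r k)"
        using pq(1)[of "r i"] pq(2)[of "r k"] by linarith+
      moreover have "d - 3 * \<eta> \<le> dist (F (x (p (r i)))) (F (x (q (r k))))"
      proof -
        have "d - 3 * \<eta> \<le> f e + f (z i) + f (- w k)"
          using f_ge[of 0] f_ge[of "Suc (2 * n)"] f_ge[of "Suc (Suc (2 * n))"] \<open>d \<le> norm e + c + c'\<close>
          by (simp add: v_def g_def Z_def C_def i_def k_def)
        also have "\<dots> = f (x (p (r i)) - x (q (r k)))"
          by (simp add: e_def z_def w_def flip: linear_add[OF f(1)])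
        also have "\<dots> \<le> dist (F (x (p (r i)))) (F (x (q (r k))))"
          by (rule F_dist)
        finally show ?thesis .
      qed
      ultimately show "\<exists>i\<ge>n. \<exists>k\<ge>n. d - 3 * \<eta> \<le> dist (F (x i)) (F (x k))"
        by blast
    qed
    also have "\<dots> \<le> weak_ca smul x"
      by (rule ca_le_weak_ca[OF bdd F])
    finally show ?thesis .
  qed
  show "ca x \<le> weak_ca smul x"
  proof (rule field_le_epsilon)
    fix \<epsilon> :: real assume "0 < \<epsilon>"
    then show "ca x \<le> weak_ca smul x + \<epsilon>"
      using main[of "ca x - \<epsilon> / 4" "\<epsilon> / 4"] by simp
  qed
qed

end

theorem proposition6p4:
  fixes smul :: "'k::real_or_complex \<Rightarrow> 'a::banach \<Rightarrow> 'a"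
  assumes "banach_space_over smul"
    and "\<And>x :: nat \<Rightarrow> 'a. bounded (range x) \<Longrightarrow>
      \<exists>n a. strict_mono (n :: nat \<Rightarrow> nat) \<and>
        (\<forall>k y. strict_mono (k :: nat \<Rightarrow> nat) \<and>
               y \<in> module.span smul ({a} \<union> range (\<lambda>i. x (n i))) \<longrightarrow>
           limsup (\<lambda>l. ereal (norm (x (n (k l)) + y))) =
             ereal (norm (y + a)) + limsup (\<lambda>l. ereal (norm (x (n (k l)) - a))))"
  shows "one_Schur smul \<and> one_strong_Schur smul"
proof -
  interpret banach_space_over smul by (rule assms(1))
  have property: "\<exists>(r :: nat \<Rightarrow> nat) a c. strict_mono r \<and> (\<forall>y \<in> span ({a} \<union> range (\<lambda>i. x (r i))).
      (\<lambda>i. norm (x (r i) - a + y)) \<longlonglongrightarrow> norm y + c)" if "bounded (range x)" for x :: "nat \<Rightarrow> 'a"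
  proof -
    from assms(2)[OF that] obtain n a where n: "strict_mono (n :: nat \<Rightarrow> nat)"
      and lim: "\<forall>k y. strict_mono (k :: nat \<Rightarrow> nat) \<and> y \<in> span ({a} \<union> range (\<lambda>i. x (n i))) \<longrightarrow>
           limsup (\<lambda>l. ereal (norm (x (n (k l)) + y))) =
             ereal (norm (y + a)) + limsup (\<lambda>l. ereal (norm (x (n (k l)) - a)))"
      by blast
    have "\<exists>(r :: nat \<Rightarrow> nat) c. strict_mono r \<and> (\<forall>y \<in> span ({a} \<union> range (\<lambda>i. x (r i))).
        (\<lambda>i. norm (x (r i) - a + y)) \<longlonglongrightarrow> norm y + c)"
      using that n by (rule subseq_tendsto_on_span) (use lim in blast)
    then show ?thesis by blast
  qed
  have subseq: "\<exists>(r :: nat \<Rightarrow> nat) a c. strict_mono r \<and> ell1_type (\<lambda>i. x (r i) - a) c"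
    if x: "bounded (range x)" for x :: "nat \<Rightarrow> 'a"
  proof -
    from property[OF x] obtain r a c where r: "strict_mono (r :: nat \<Rightarrow> nat)"
      and lim: "\<forall>y \<in> span ({a} \<union> range (\<lambda>i. x (r i))).
        (\<lambda>i. norm (x (r i) - a + y)) \<longlonglongrightarrow> norm y + c"
      by blast
    have "bounded (range (\<lambda>i. x (r i)))"
      using x by (rule bounded_subset) auto
    from ell1_type_of_tendsto_on_span[OF property this bspec[OF lim]] have "ell1_type (\<lambda>i. x (r i) - a) c" .
    with r show ?thesis by blast
  qed
  show ?thesis
    using one_Schur_of_ell1_type_subseq[OF subseq] one_strong_Schur_of_ell1_type_subseq[OF subseq]
    by blast
qed

end
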